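(* Let $\varepsilon>0$, $A_0\ge A_0^\star:=\frac95\left(\frac2{15}\right)^{2/3}$ and $A\ge\frac49A_0^2$. Let $\phi^{k}\in\mathcal{C}_{\rm per}$ with $\|\phi^k\|_\infty\le M_h$, $k=n,n-1$, for some $M_h>0$, with $\overline{\phi^{n}}=\overline{\phi^{n-1}}=\beta_0>0$ and $\phi^n>0$ point-wise, and let $\phi^{n+1}\in\mathcal{C}_{\rm per}$ be the unique point-wise positive solution with $\phi^{n+1}-\phi^n\in\mathring{\mathcal{C}}_{\rm per}$ of the scheme $$\frac{\frac32\phi^{n+1}-2\phi^n+\frac12\phi^{n-1}}{\Delta t}=\Delta_h\mu^{n+1},$$ $$\mu^{n+1}=-\frac83\left((\phi^{n+1})^{-9}-(\phi^{n+1})^{-3}\right)+\frac83A_0(\phi^{n+1}-\check\phi^{n+1})-A\,\Delta t\,\Delta_h(\phi^{n+1}-\phi^n)-\varepsilon^2\Delta_h\phi^{n+1},$$ where $\check\phi^{n+1}:=2\phi^n-\phi^{n-1}$. Then, for any $\Delta t,h>0$, $$\tilde F_h(\phi^{n+1},\phi^n)\le\tilde F_h(\phi^n,\phi^{n-1}),$$ where $$\tilde F_h(\phi^{n+1},\phi^n):=F_h(\phi^{n+1})+\frac1{4\Delta t}\|\phi^{n+1}-\phi^n\|_{-1,h}^2+\frac43A_0\|\phi^{n+1}-\phi^n\|_2^2$$ and $$F_h(\phi):=\frac13\langle\phi^{-8},1\rangle_\Omega+\frac{\varepsilon^2}2\|\nabla_h\phi\|_2^2-\frac43\langle\phi^{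-2},1\rangle_\Omega.$$
   Context: Let $\Omega=(0,L)^3$, $L>0$, $N\in\mathbb{N}$, $h=L/N$. $\mathcal{C}_{\rm per}$ is the space of real grid functions $\upsilon=(\upsilon_{i,j,k})_{i,j,k\in\mathbb{Z}}$ that are $N$-periodic in each index, where $\upsilon_{i,j,k}=\upsilon(p_i,p_j,p_k)$, $p_i=(i-\tfrac12)h$. The mean is $\overline{\upsilon}=\frac{h^3}{|\Omega|}\sum_{i,j,k=1}^N\upsilon_{i,j,k}$, $\mathring{\mathcal{C}}_{\rm per}=\{\upsilon\in\mathcal{C}_{\rm per}:\overline\upsilon=0\}$, and $\|\upsilon\|_\infty=\max_{1\le i,j,k\le N}|\upsilon_{i,j,k}|$. The discrete Laplacian is $$\Delta_h\upsilon_{i,j,k}=\frac1{h^2}(\upsilon_{i+1,j,k}+\upsilon_{i-1,j,k}+\upsilon_{i,j+1,k}+\upsilon_{i,j-1,k}+\upsilon_{i,j,k+1}+\upsilon_{i,j,k-1}-6\upsilon_{i,j,k}).$$ The grid inner product is $\langle\upsilon,\xi\rangle_\Omega=h^3\sum_{i,j,k=1}^N\upsilon_{i,j,k}\xi_{i,j,k}$, $\|\upsilon\|_2^2=\langle\upsilon,\upsilon\rangle_\Omega$, and $$\|\nabla_h\upsilon\|_2^2=h^3\sum_{i,j,k=1}^N\frac{(\upsilon_{i+1,j,k}-\upsilon_{i,j,k})^2+(\upsilon_{i,j+1,k}-\upsilon_{i,j,k})^2+(\upsilon_{i,j,k+1}-\upsilon_{i,j,k})^2}{h^2}.$$ For $f\in\mathring{\mathcal{C}}_{\rm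 per}$, $(-\Delta_h)^{-1}f$ is the unique $\psi\in\mathring{\mathcal{C}}_{\rm per}$ with $-\Delta_h\psi=f$, and $\|f\|_{-1,h}=\langle f,(-\Delta_h)^{-1}f\rangle_\Omega^{1/2}$. Powers of grid functions are taken point-wise. *)

theory Defs
  imports Complex_Main
begin

text \<open>A grid function on the cell-centred mesh of the periodic box (0,L)^3 is represented by its
  array of values: \<open>u i j k\<close> is the value at the mesh point with coordinates
  ((i - 1/2) h, (j - 1/2) h, (k - 1/2) h), where h = L/N.\<close>

type_synonym grid_fun = "int \<Rightarrow> int \<Rightarrow> int \<Rightarrow> real"

definition mesh :: "real \<Rightarrow> nat \<Rightarrow> real" where
  "mesh L N = L / real N"

definition C_per :: "nat \<Rightarrow> grid_fun set" where
  "C_per N = {u. \<forall>i j k. u (i + int N) j k = u i j k \<and>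
                          u i (j + int N) k = u i j k \<and>
                          u i j (k + int N) = u i j k}"

definition grid_sum :: "nat \<Rightarrow> grid_fun \<Rightarrow> real" where
  "grid_sum N u = (\<Sum>i=1..int N. \<Sum>j=1..int N. \<Sum>k=1..int N. u i j k)"

text \<open>The factor L^3 is the volume of the box.\<close>

definition grid_mean :: "real \<Rightarrow> nat \<Rightarrow> grid_fun \<Rightarrow> real" where
  "grid_mean L N u = mesh L N ^ 3 / L ^ 3 * grid_sum N u"

definition C_per0 :: "real \<Rightarrow> nat \<Rightarrow> grid_fun set" where
  "C_per0 L N = {u \<in> C_per N. grid_mean L N u = 0}"

text \<open>The maximum is over a nonempty set only if N is positive.\<close>

definition grid_norm_inf :: "nat \<Rightarrow> grid_fun \<Rightarrow> real" where
  "grid_norm_inf N u =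
     Max {\<bar>u i j k\<bar> | i j k. i \<in> {1..int N} \<and> j \<in> {1..int N} \<and> k \<in> {1..int N}}"

definition grid_inner :: "real \<Rightarrow> nat \<Rightarrow> grid_fun \<Rightarrow> grid_fun \<Rightarrow> real" where
  "grid_inner L N u v = mesh L N ^ 3 * grid_sum N (\<lambda>i j k. u i j k * v i j k)"

definition grid_norm2 :: "real \<Rightarrow> nat \<Rightarrow> grid_fun \<Rightarrow> real" where
  "grid_norm2 L N u = sqrt (grid_inner L N u u)"

definition grad_norm2 :: "real \<Rightarrow> nat \<Rightarrow> grid_fun \<Rightarrow> real" where
  "grad_norm2 L N u = sqrt (mesh L N ^ 3 * grid_sum N (\<lambda>i j k.
     ((u (i + 1) j k - u i j k)\<^sup>2 + (u i (j + 1) k - u i j k)\<^sup>2 + (u i j (k + 1) - u i j k)\<^sup>2)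
     / (mesh L N)\<^sup>2))"

definition lap :: "real \<Rightarrow> nat \<Rightarrow> grid_fun \<Rightarrow> grid_fun" where
  "lap L N u = (\<lambda>i j k. 1 / (mesh L N)\<^sup>2 *
     (u (i + 1) j k + u (i - 1) j k + u i (j + 1) k + u i (j - 1) k
      + u i j (k + 1) + u i j (k - 1) - 6 * u i j k))"

definition grid_diff :: "grid_fun \<Rightarrow> grid_fun \<Rightarrow> grid_fun" where
  "grid_diff u v = (\<lambda>i j k. u i j k - v i j k)"

text \<open>Inverse of the negative discrete Laplacian on mean-zero periodic grid functions;
  meaningful only for \<open>f \<in> C_per0 L N\<close>.\<close>

definition inv_neg_lap :: "real \<Rightarrow> nat \<Rightarrow> grid_fun \<Rightarrow> grid_fun" where
  "inv_neg_lap L N f =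
     (THE \<psi>. \<psi> \<in> C_per0 L N \<and> (\<forall>i j k. - lap L N \<psi> i j k = f i j k))"

definition norm_m1 :: "real \<Rightarrow> nat \<Rightarrow> grid_fun \<Rightarrow> real" where
  "norm_m1 L N f = sqrt (grid_inner L N f (inv_neg_lap L N f))"

definition F_h :: "real \<Rightarrow> nat \<Rightarrow> real \<Rightarrow> grid_fun \<Rightarrow> real" where
  "F_h L N \<epsilon> \<phi> =
     1/3 * grid_inner L N (\<lambda>i j k. \<phi> i j k powi (-8)) (\<lambda>_ _ _. 1)
     + \<epsilon>\<^sup>2 / 2 * (grad_norm2 L N \<phi>)\<^sup>2
     - 4/3 * grid_inner L N (\<lambda>i j k. \<phi> i j k powi (-2)) (\<lambda>_ _ _. 1)"

text \<open>The modified energy; \<open>\<psi>\<close> is the value at the new time level, \<open>\<phi>\<close> at the previous one.\<close>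

definition F_h_mod ::
  "real \<Rightarrow> nat \<Rightarrow> real \<Rightarrow> real \<Rightarrow> real \<Rightarrow> grid_fun \<Rightarrow> grid_fun \<Rightarrow> real" where
  "F_h_mod L N \<epsilon> A0 dt \<psi> \<phi> =
     F_h L N \<epsilon> \<psi>
     + 1 / (4 * dt) * (norm_m1 L N (grid_diff \<psi> \<phi>))\<^sup>2
     + 4/3 * A0 * (grid_norm2 L N (grid_diff \<psi> \<phi>))\<^sup>2"

text \<open>In the scheme, \<open>\<phi>0\<close>, \<open>\<phi>1\<close>, \<open>\<phi>2\<close> are the time levels n - 1, n, n + 1.\<close>

definition extrapolation :: "grid_fun \<Rightarrow> grid_fun \<Rightarrow> grid_fun" where
  "extrapolation \<phi>0 \<phi>1 = (\<lambda>i j k. 2 * \<phi>1 i j k - \<phi>0 i j k)"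

definition chem_pot ::
  "real \<Rightarrow> nat \<Rightarrow> real \<Rightarrow> real \<Rightarrow> real \<Rightarrow> real \<Rightarrow> grid_fun \<Rightarrow> grid_fun \<Rightarrow> grid_fun \<Rightarrow> grid_fun" where
  "chem_pot L N \<epsilon> A0 A dt \<phi>0 \<phi>1 \<phi>2 = (\<lambda>i j k.
     - 8/3 * (\<phi>2 i j k powi (-9) - \<phi>2 i j k powi (-3))
     + 8/3 * A0 * (\<phi>2 i j k - extrapolation \<phi>0 \<phi>1 i j k)
     - A * dt * lap L N (grid_diff \<phi>2 \<phi>1) i j k
     - \<epsilon>\<^sup>2 * lap L N \<phi>2 i j k)"

definition bdf2_scheme ::
  "real \<Rightarrow> nat \<Rightarrow> real \<Rightarrow> real \<Rightarrow> real \<Rightarrow> real \<Rightarrow> grid_fun \<Rightarrow> grid_fun \<Rightarrow> grid_fun \<Rightarrow> bool" where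
  "bdf2_scheme L N \<epsilon> A0 A dt \<phi>0 \<phi>1 \<phi>2 \<longleftrightarrow>
     (\<forall>i j k. (3/2 * \<phi>2 i j k - 2 * \<phi>1 i j k + 1/2 * \<phi>0 i j k) / dt
             = lap L N (chem_pot L N \<epsilon> A0 A dt \<phi>0 \<phi>1 \<phi>2) i j k)"

end

theory Submission
  imports Defs "HOL-Analysis.Convex"
begin

text \<open>
  Why the modified energy decays. Write \<open>d = \<phi>2 - \<phi>1\<close>, \<open>e = \<phi>1 - \<phi>0\<close>, and let \<open>\<psi>\<close>, \<open>\<eta>\<close> solve the
  discrete Poisson problems \<open>-\<Delta>\<psi> = d\<close>, \<open>-\<Delta>\<eta> = e\<close> with mean zero. The left-hand side of the scheme
  is \<open>(3d/2 - e/2)/\<Delta>t\<close>; pairing the scheme with \<open>\<psi>\<close> and moving the Laplacian across turns it into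
  the balance \<open>\<langle>3d/2 - e/2, \<psi>\<rangle>/\<Delta>t + \<langle>\<mu>, d\<rangle> = 0\<close>.  Each term is then bounded from below by a
  difference of energies:

  \<^item> since \<open>\<langle>d, \<psi>\<rangle> = \<parallel>\<nabla>\<psi>\<parallel>\<^sup>2 = \<parallel>d\<parallel>\<^sup>2\<close> in the \<open>H^-1\<close> norm, the first term is at least
    \<open>(5\<parallel>\<nabla>\<psi>\<parallel>\<^sup>2 - \<parallel>\<nabla>\<eta>\<parallel>\<^sup>2)/(4\<Delta>t)\<close>, i.e. the \<open>H^-1\<close> part of the modified energy difference plus a
    surplus \<open>\<parallel>\<nabla>\<psi>\<parallel>\<^sup>2/\<Delta>t\<close>;
  \<^item> the surface energy and the extrapolation term are quadratic, and polarisation suffices;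
  \<^item> the Lennard-Jones potential \<open>\<phi>^-8/3 - 4\<phi>^-2/3\<close> is not convex, but the threshold on \<open>A0\<close> is
    exactly the one at which adding \<open>4 A0 \<phi>\<^sup>2/3\<close> makes it convex (\<open>lennard_jones_convexified\<close>).
    Its increment therefore costs at most an extra \<open>4 A0 \<parallel>d\<parallel>\<^sup>2/3\<close> (\<open>lennard_jones_tangent\<close>).

  The extra cost is paid by the surplus together with the artificial regularisation: because
  \<open>\<parallel>d\<parallel>\<^sup>2 = \<langle>\<nabla>\<psi>, \<nabla>d\<rangle>\<close>, Young's inequality yields
  \<open>4 A0 \<parallel>d\<parallel>\<^sup>2/3 \<le> \<parallel>\<nabla>\<psi>\<parallel>\<^sup>2/\<Delta>t + (4/9) A0\<^sup>2 \<Delta>t \<parallel>\<nabla>d\<parallel>\<^sup>2\<close>, which explains the condition on \<open>A\<close>.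

  The inverse Laplacian is given by a definite description, so the argument also needs unique
  solvability of the discrete Poisson problem.  Uniqueness follows from summation by parts.  For
  existence, a periodic function with vanishing Laplacian is constant, so the functional
  \<open>\<langle>f, \<cdot>\<rangle>\<close> of a mean-zero \<open>f\<close> vanishes on the common kernel of the functionals \<open>v \<mapsto> \<Delta>v(p)\<close>,
  \<open>p\<close> a mesh point of one period cell, and hence is a linear combination of them (\<open>functional_in_span\<close>); the
  coefficients, read as a grid function, solve the problem by symmetry of the Laplacian.
\<close>

section \<open>Periodic grid functions and their sums\<close>

lemma C_perI:
  assumes "\<And>i j k. u (i + int N) j k = u i j k"
    and "\<And>i j k. u i (j + int N) k = u i j k"
    and "\<And>i j k. u i j (k + int N) = u i j k"
  shows "u \<in> C_per N"
  using assms by (simp add: C_per_def)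

lemma C_perD:
  assumes "u \<in> C_per N"
  shows "u (i + int N) j k = u i j k" "u i (j + int N) k = u i j k" "u i j (k + int N) = u i j k"
  using assms by (auto simp: C_per_def)

lemma C_perD_shift:
  assumes "u \<in> C_per N"
  shows "u (i + int N + a) j k = u (i + a) j k" "u i (j + int N + a) k = u i (j + a) k"
    "u i j (k + int N + a) = u i j (k + a)"
    "u (i + int N - a) j k = u (i - a) j k" "u i (j + int N - a) k = u i (j - a) k"
    "u i j (k + int N - a) = u i j (k - a)"
  using C_perD[OF assms, of "i + a" j k] C_perD[OF assms, of i "j + a" k]
    C_perD[OF assms, of i j "k + a"] C_perD[OF assms, of "i - a" j k]
    C_perD[OF assms, of i "j - a" k] C_perD[OF assms, of i j "k - a"]
  by (simp_all add: algebra_simps)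

lemma C_per_const: "(\<lambda>i j k. c) \<in> C_per N"
  by (simp add: C_per_def)

lemma C_per_combine:
  assumes "u \<in> C_per N" "v \<in> C_per N"
  shows "(\<lambda>i j k. u i j k + c * v i j k) \<in> C_per N"
  by (intro C_perI) (simp_all add: C_perD[OF assms(1)] C_perD[OF assms(2)])

lemma C_per_grid_diff:
  assumes "u \<in> C_per N" "v \<in> C_per N"
  shows "grid_diff u v \<in> C_per N"
  using C_per_combine[OF assms, of "-1"] by (simp add: grid_diff_def)

lemma C_per_lap:
  assumes "u \<in> C_per N"
  shows "lap L N u \<in> C_per N"
  by (intro C_perI) (simp_all add: lap_def C_perD[OF assms] C_perD_shift[OF assms])

text \<open>The period cell is enumerated by \<open>{1..N}\<close>, so the representative of \<open>i\<close> is one plus the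
  remainder of \<open>i - 1\<close>.\<close>

lemma periodic_representative:
  fixes f :: "int \<Rightarrow> 'a"
  assumes "N \<ge> 1" and per: "\<And>i. f (i + int N) = f i"
  shows "\<exists>i'\<in>{1..int N}. f i = f i'"
proof
  have up: "f (i + int n * int N) = f i" for i n
  proof (induction n)
    case (Suc n)
    have "f (i + int (Suc n) * int N) = f (i + int n * int N + int N)"
      by (simp add: algebra_simps)
    with per Suc show ?case by simp
  qed simp
  have mult: "f (i + m * int N) = f i" for i m
  proof (cases "m \<ge> 0")
    case True
    with up[of i "nat m"] show ?thesis by simp
  next
    case False
    with up[of "i + m * int N" "nat (-m)"] show ?thesis by (simp add: algebra_simps)
  qed
  have "i = (i - 1) mod int N + 1 + (i - 1) div int N * int N"
    using div_mult_mod_eq[of "i - 1" "int N"] by linarith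
  with mult[of "(i - 1) mod int N + 1" "(i - 1) div int N"]
  show "f i = f ((i - 1) mod int N + 1)" by simp
  have "0 \<le> (i - 1) mod int N" "(i - 1) mod int N < int N"
    using assms(1) by simp_all
  then show "(i - 1) mod int N + 1 \<in> {1..int N}" by simp
qed

lemma C_per_representative:
  assumes "N \<ge> 1" and u: "u \<in> C_per N"
  shows "\<exists>i'\<in>{1..int N}. \<exists>j'\<in>{1..int N}. \<exists>k'\<in>{1..int N}. u i j k = u i' j' k'"
proof -
  obtain i' where "i' \<in> {1..int N}" "u i j k = u i' j k"
    using periodic_representative[OF assms(1), of "\<lambda>i. u i j k" i] C_perD[OF u] by auto
  moreover obtain j' where "j' \<in> {1..int N}" "u i' j k = u i' j' k"
    using periodic_representative[OF assms(1), of "\<lambda>j. u i' j k" j] C_perD[OF u] by auto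
  moreover obtain k' where "k' \<in> {1..int N}" "u i' j' k = u i' j' k'"
    using periodic_representative[OF assms(1), of "\<lambda>k. u i' j' k" k] C_perD[OF u] by auto
  ultimately show ?thesis by force
qed

lemma grid_sum_add: "grid_sum N (\<lambda>i j k. u i j k + v i j k) = grid_sum N u + grid_sum N v"
  by (simp add: grid_sum_def sum.distrib)

lemma grid_sum_diff: "grid_sum N (\<lambda>i j k. u i j k - v i j k) = grid_sum N u - grid_sum N v"
  by (simp add: grid_sum_def sum_subtractf)

lemma grid_sum_cmult: "grid_sum N (\<lambda>i j k. c * u i j k) = c * grid_sum N u"
  by (simp add: grid_sum_def sum_distrib_left)

lemma grid_sum_const: "grid_sum N (\<lambda>i j k. c) = real N ^ 3 * c"
  by (simp add: grid_sum_def power3_eq_cube)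

lemma grid_sum_mono: "(\<And>i j k. u i j k \<le> v i j k) \<Longrightarrow> grid_sum N u \<le> grid_sum N v"
  unfolding grid_sum_def by (intro sum_mono) auto

lemma grid_sum_nonneg: "(\<And>i j k. u i j k \<ge> 0) \<Longrightarrow> grid_sum N u \<ge> 0"
  unfolding grid_sum_def by (intro sum_nonneg) auto

lemma grid_sum_eq_0_imp:
  assumes "N \<ge> 1" and per: "u \<in> C_per N"
    and nonneg: "\<And>i j k. u i j k \<ge> 0" and "grid_sum N u = 0"
  shows "u i j k = 0"
proof -
  have "u i j k = 0" if "i \<in> {1..int N}" "j \<in> {1..int N}" "k \<in> {1..int N}" for i j k
    using assms(4) that unfolding grid_sum_def
    by (simp add: sum_nonneg_eq_0_iff sum_nonneg nonneg)
  with C_per_representative[OF assms(1) per, of i j k] show ?thesis by force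
qed

lemma sum_shift_periodic:
  fixes f :: "int \<Rightarrow> real"
  assumes "\<And>i. f (i + int N) = f i"
  shows "(\<Sum>i=1..int N. f (i + 1)) = (\<Sum>i=1..int N. f i)"
proof -
  have "(\<Sum>i=1..int N. f (i + 1)) = sum f {2..int N + 1}"
    by (rule sum.reindex_bij_witness[of _ "\<lambda>i. i - 1" "\<lambda>i. i + 1"]) auto
  moreover have "sum f {1..int N + 1} = f 1 + sum f {2..int N + 1}"
  proof -
    have "{1..int N + 1} = insert 1 {2..int N + 1}" by auto
    then show ?thesis by simp
  qed
  moreover have "sum f {1..int N + 1} = f (int N + 1) + sum f {1..int N}"
  proof -
    have "{1..int N + 1} = insert (int N + 1) {1..int N}" by auto
    then show ?thesis by simp
  qed
  ultimately show ?thesis using assms[of 1] by (simp add: add.commute)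
qed

lemma grid_sum_shift:
  assumes "u \<in> C_per N"
  shows "grid_sum N (\<lambda>i j k. u (i + 1) j k) = grid_sum N u"
    "grid_sum N (\<lambda>i j k. u i (j + 1) k) = grid_sum N u"
    "grid_sum N (\<lambda>i j k. u i j (k + 1)) = grid_sum N u"
proof -
  show "grid_sum N (\<lambda>i j k. u (i + 1) j k) = grid_sum N u"
    unfolding grid_sum_def
    by (rule sum_shift_periodic[of "\<lambda>i. \<Sum>j=1..int N. \<Sum>k=1..int N. u i j k"])
      (simp add: C_perD[OF assms])
  show "grid_sum N (\<lambda>i j k. u i (j + 1) k) = grid_sum N u"
    unfolding grid_sum_def
    by (intro sum.cong refl sum_shift_periodic[of "\<lambda>j. \<Sum>k=1..int N. u _ j k"])
      (simp add: C_perD[OF assms])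
  show "grid_sum N (\<lambda>i j k. u i j (k + 1)) = grid_sum N u"
    unfolding grid_sum_def
    by (intro sum.cong refl sum_shift_periodic) (simp add: C_perD[OF assms])
qed

section \<open>The Dirichlet form and summation by parts\<close>

definition grad_inner :: "real \<Rightarrow> nat \<Rightarrow> grid_fun \<Rightarrow> grid_fun \<Rightarrow> real" where
  "grad_inner L N u v = mesh L N ^ 3 * grid_sum N (\<lambda>i j k.
     ((u (i + 1) j k - u i j k) * (v (i + 1) j k - v i j k)
      + (u i (j + 1) k - u i j k) * (v i (j + 1) k - v i j k)
      + (u i j (k + 1) - u i j k) * (v i j (k + 1) - v i j k)) / (mesh L N)\<^sup>2)"

lemma mesh_nonneg: "L > 0 \<Longrightarrow> mesh L N \<ge> 0"
  by (simp add: mesh_def)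

lemma mesh_pos: "L > 0 \<Longrightarrow> N \<ge> 1 \<Longrightarrow> mesh L N > 0"
  by (simp add: mesh_def)

lemma grid_inner_commute: "grid_inner L N u v = grid_inner L N v u"
  by (simp add: grid_inner_def mult.commute)

lemma grid_inner_combine_left:
  "grid_inner L N (\<lambda>i j k. u i j k + c * v i j k) w
     = grid_inner L N u w + c * grid_inner L N v w"
proof -
  have "grid_sum N (\<lambda>i j k. (u i j k + c * v i j k) * w i j k)
    = grid_sum N (\<lambda>i j k. u i j k * w i j k) + c * grid_sum N (\<lambda>i j k. v i j k * w i j k)"
    unfolding grid_sum_cmult[symmetric] grid_sum_add[symmetric] by (simp add: algebra_simps)
  then show ?thesis by (simp add: grid_inner_def algebra_simps)
qed

lemma grid_inner_self_nonneg: "L > 0 \<Longrightarrow> grid_inner L N u u \<ge> 0"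
  by (simp add: grid_inner_def mesh_nonneg grid_sum_nonneg)

lemma grad_inner_commute: "grad_inner L N u v = grad_inner L N v u"
  by (simp add: grad_inner_def mult.commute)

lemma grad_inner_combine_left:
  "grad_inner L N (\<lambda>i j k. u i j k + c * v i j k) w
     = grad_inner L N u w + c * grad_inner L N v w"
proof -
  let ?g = "\<lambda>u i j k. ((u (i + 1) j k - u i j k) * (w (i + 1) j k - w i j k)
      + (u i (j + 1) k - u i j k) * (w i (j + 1) k - w i j k)
      + (u i j (k + 1) - u i j k) * (w i j (k + 1) - w i j k)) / (mesh L N)\<^sup>2"
  have "grid_sum N (?g (\<lambda>i j k. u i j k + c * v i j k))
    = grid_sum N (?g u) + c * grid_sum N (?g v)"
    unfolding grid_sum_cmult[symmetric] grid_sum_add[symmetric]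
    by (intro arg_cong[where f = "grid_sum N"] ext)
      (simp add: algebra_simps add_divide_distrib diff_divide_distrib)
  then show ?thesis by (simp add: grad_inner_def algebra_simps)
qed

lemma grad_inner_self_nonneg: "L > 0 \<Longrightarrow> grad_inner L N u u \<ge> 0"
  by (simp add: grad_inner_def mesh_nonneg grid_sum_nonneg)

lemma grad_inner_square:
  "grad_inner L N (\<lambda>i j k. u i j k + c * v i j k) (\<lambda>i j k. u i j k + c * v i j k)
     = grad_inner L N u u + 2 * c * grad_inner L N u v + c\<^sup>2 * grad_inner L N v v"
  by (simp add: grad_inner_combine_left algebra_simps power2_eq_square
      grad_inner_commute[of L N _ "\<lambda>i j k. u i j k + c * v i j k"] grad_inner_commute[of L N v u])

lemma grad_norm2_squared: "L > 0 \<Longrightarrow> (grad_norm2 L N u)\<^sup>2 = grad_inner L N u u"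
  using grad_inner_self_nonneg[of L N u]
  by (simp add: grad_norm2_def grad_inner_def power2_eq_square)

lemma grid_norm2_squared: "L > 0 \<Longrightarrow> (grid_norm2 L N u)\<^sup>2 = grid_inner L N u u"
  using grid_inner_self_nonneg[of L N u] by (simp add: grid_norm2_def)

text \<open>In each direction, with the flux \<open>Q(i) = u(i) (v(i) - v(i-1))\<close>, the second difference satisfies
  \<open>u(i) (v(i+1) - 2 v(i) + v(i-1)) = Q(i+1) - Q(i) - (u(i+1) - u(i)) (v(i+1) - v(i))\<close>, and periodicity
  makes the telescoping part sum to zero.\<close>

lemma summation_by_parts:
  assumes u: "u \<in> C_per N" and v: "v \<in> C_per N"
  shows "grid_inner L N u (lap L N v) = - grad_inner L N u v"
proof -
  define h where "h = mesh L N"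
  define Q1 Q2 Q3 where "Q1 = (\<lambda>i j k. u i j k * (v i j k - v (i - 1) j k))"
    and "Q2 = (\<lambda>i j k. u i j k * (v i j k - v i (j - 1) k))"
    and "Q3 = (\<lambda>i j k. u i j k * (v i j k - v i j (k - 1)))"
  have per: "Q1 \<in> C_per N" "Q2 \<in> C_per N" "Q3 \<in> C_per N"
    unfolding Q1_def Q2_def Q3_def
    by (intro C_perI; simp add: C_perD[OF u] C_perD[OF v] C_perD_shift[OF v])+
  let ?D = "\<lambda>i j k. ((u (i + 1) j k - u i j k) * (v (i + 1) j k - v i j k)
      + (u i (j + 1) k - u i j k) * (v i (j + 1) k - v i j k)
      + (u i j (k + 1) - u i j k) * (v i j (k + 1) - v i j k)) / h\<^sup>2"
  have flux: "u i j k * lap L N v i j k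
      = 1 / h\<^sup>2 * ((Q1 (i + 1) j k - Q1 i j k) + ((Q2 i (j + 1) k - Q2 i j k)
          + (Q3 i j (k + 1) - Q3 i j k))) - ?D i j k" for i j k
    unfolding lap_def Q1_def Q2_def Q3_def h_def[symmetric]
    by (cases "h = 0") (simp_all add: field_simps)
  have "grid_sum N (\<lambda>i j k. u i j k * lap L N v i j k) = - grid_sum N ?D"
    unfolding flux grid_sum_diff grid_sum_add grid_sum_cmult
    by (simp add: grid_sum_shift per)
  then show ?thesis by (simp add: grid_inner_def grad_inner_def h_def)
qed

lemma lap_symmetric:
  assumes "u \<in> C_per N" "v \<in> C_per N"
  shows "grid_inner L N u (lap L N v) = grid_inner L N (lap L N u) v"
  using summation_by_parts[OF assms, of L] summation_by_parts[OF assms(2,1), of L]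
  by (metis grad_inner_commute grid_inner_commute)

section \<open>The discrete Poisson problem\<close>

text \<open>Read \<open>comb u c v\<close> as \<open>u + c v\<close>; grid functions carry no vector space type class, so the operation
  is a parameter.  The proof is elimination: either the last functional vanishes on all of \<open>V\<close>, or
  a vector \<open>w\<close> outside its kernel splits every \<open>v\<close> into a multiple of \<open>w\<close> and an element of its kernel, where the induction
  hypothesis applies.\<close>

lemma functional_in_span:
  fixes l :: "'v \<Rightarrow> real" and m :: "'p \<Rightarrow> 'v \<Rightarrow> real"
    and comb :: "'v \<Rightarrow> real \<Rightarrow> 'v \<Rightarrow> 'v"
  assumes "finite S"
    and "\<And>u v c. u \<in> V \<Longrightarrow> v \<in> V \<Longrightarrow> comb u c v \<in> V"
    and "\<And>u v c. u \<in> V \<Longrightarrow> v \<in> V \<Longrightarrow> l (comb u c v) = l u + c * l v"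
    and "\<And>p u v c. u \<in> V \<Longrightarrow> v \<in> V \<Longrightarrow> m p (comb u c v) = m p u + c * m p v"
    and "\<And>v. v \<in> V \<Longrightarrow> (\<And>p. p \<in> S \<Longrightarrow> m p v = 0) \<Longrightarrow> l v = 0"
  shows "\<exists>c. \<forall>v\<in>V. l v = (\<Sum>p\<in>S. c p * m p v)"
  using assms
proof (induction S arbitrary: V rule: finite_induct)
  case empty
  then show ?case by simp
next
  case (insert q S)
  note comb = insert.prems(1) and l = insert.prems(2) and m = insert.prems(3)
  define K where "K = {v \<in> V. m q v = 0}"
  have "\<exists>c. \<forall>v\<in>K. l v = (\<Sum>p\<in>S. c p * m p v)"
  proof (rule insert.IH)
    show "l v = 0" if "v \<in> K" "\<And>p. p \<in> S \<Longrightarrow> m p v = 0" for v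
      using that insert.prems(4)[of v] by (auto simp: K_def)
  qed (use comb l m in \<open>auto simp: K_def\<close>)
  then obtain c where c: "\<And>v. v \<in> K \<Longrightarrow> l v = (\<Sum>p\<in>S. c p * m p v)" by blast
  show ?case
  proof (cases "\<exists>w\<in>V. m q w \<noteq> 0")
    case False
    then have "V = K" by (auto simp: K_def)
    have "(\<Sum>p\<in>insert q S. (c(q := 0)) p * m p v) = (\<Sum>p\<in>S. c p * m p v)" for v
      using insert.hyps by (auto intro: sum.cong)
    with c \<open>V = K\<close> show ?thesis by metis
  next
    case True
    then obtain w where w: "w \<in> V" "m q w \<noteq> 0" by blast
    define b where "b = (l w - (\<Sum>p\<in>S. c p * m p w)) / m q w"
    have "l v = (\<Sum>p\<in>insert q S. (c(q := b)) p * m p v)" if v: "v \<in> V" for v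
    proof -
      define a where "a = - m q v / m q w"
      have "comb v a w \<in> K"
        using v w comb by (simp add: K_def m a_def)
      from c[OF this] have "l v + a * l w = (\<Sum>p\<in>S. c p * (m p v + a * m p w))"
        using v w by (simp add: l m)
      also have "\<dots> = (\<Sum>p\<in>S. c p * m p v) + a * (\<Sum>p\<in>S. c p * m p w)"
        by (simp add: algebra_simps sum.distrib sum_distrib_left)
      finally have "l v = (\<Sum>p\<in>S. c p * m p v) + b * m q v"
        using w by (simp add: a_def b_def field_simps)
      moreover have "(\<Sum>p\<in>S. (c(q := b)) p * m p v) = (\<Sum>p\<in>S. c p * m p v)"
        using insert.hyps by (auto intro: sum.cong)
      ultimately show ?thesis using insert.hyps by simp
    qed
    then show ?thesis by blast
  qed
qed

lemma constant_if_shift_invariant: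
  fixes f :: "int \<Rightarrow> real"
  assumes "\<And>i. f (i + 1) = f i"
  shows "f i = f 0"
proof (induction i rule: int_induct[where k = 0])
  case (step2 i)
  with assms[of "i - 1"] show ?case by simp
qed (use assms in auto)

text \<open>A discrete harmonic function has vanishing Dirichlet form, hence vanishing differences.\<close>

lemma lap_eq_0_imp_constant:
  assumes "L > 0" "N \<ge> 1" and u: "u \<in> C_per N" and lap0: "\<And>i j k. lap L N u i j k = 0"
  shows "u i j k = u 0 0 0"
proof -
  define h where "h = mesh L N"
  have "h > 0" using mesh_pos assms by (simp add: h_def)
  define E where "E = (\<lambda>i j k. ((u (i + 1) j k - u i j k)\<^sup>2 + (u i (j + 1) k - u i j k)\<^sup>2
      + (u i j (k + 1) - u i j k)\<^sup>2) / h\<^sup>2)"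
  have "E \<in> C_per N" unfolding E_def
    by (intro C_perI) (simp_all add: C_perD[OF u] C_perD_shift[OF u])
  have "grad_inner L N u u = 0"
    using summation_by_parts[OF u u, of L] lap0 by (simp add: grid_inner_def grid_sum_const)
  then have "grid_sum N E = 0"
    using \<open>h > 0\<close> by (simp add: grad_inner_def E_def h_def power2_eq_square)
  have "E i j k = 0" for i j k
    by (rule grid_sum_eq_0_imp[OF \<open>N \<ge> 1\<close> \<open>E \<in> C_per N\<close> _ \<open>grid_sum N E = 0\<close>]) (simp add: E_def)
  then have "(u (i + 1) j k - u i j k)\<^sup>2 + (u i (j + 1) k - u i j k)\<^sup>2
      + (u i j (k + 1) - u i j k)\<^sup>2 = 0" for i j k
    using \<open>h > 0\<close> by (simp add: E_def)
  then have "u (i + 1) j k = u i j k \<and> u i (j + 1) k = u i j k \<and> u i j (k + 1) = u i j k"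
    for i j k
    by (smt (verit) zero_le_power2 power2_less_0 zero_eq_power2)
  then show ?thesis
    using constant_if_shift_invariant[of "\<lambda>i. u i j k"]
      constant_if_shift_invariant[of "\<lambda>j. u 0 j k"] constant_if_shift_invariant[of "\<lambda>k. u 0 0 k"]
    by metis
qed

lemma C_per0_iff:
  assumes "L > 0" "N \<ge> 1"
  shows "u \<in> C_per0 L N \<longleftrightarrow> u \<in> C_per N \<and> grid_sum N u = 0"
  using mesh_pos[OF assms] assms by (simp add: C_per0_def grid_mean_def)

lemma lap_combine:
  "lap L N (\<lambda>i j k. u i j k + c * v i j k) i j k = lap L N u i j k + c * lap L N v i j k"
  by (simp add: lap_def algebra_simps)

lemma poisson_solvable_up_to_constant:
  assumes "L > 0" "N \<ge> 1" and f: "f \<in> C_per0 L N"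
  shows "\<exists>u\<in>C_per N. \<forall>i j k. lap L N u i j k = f i j k"
proof -
  have h: "mesh L N > 0" using mesh_pos assms by simp
  have fp: "f \<in> C_per N" and f0: "grid_sum N f = 0"
    using f C_per0_iff assms by auto
  define I where "I = {1..int N} \<times> {1..int N} \<times> {1..int N}"
  have sumI: "grid_sum N u = (\<Sum>(i, j, k)\<in>I. u i j k)" for u
    by (simp add: grid_sum_def I_def sum.cartesian_product)
  have "\<exists>c. \<forall>v\<in>C_per N. grid_inner L N f v
      = (\<Sum>p\<in>I. c p * (case p of (i, j, k) \<Rightarrow> lap L N v i j k))"
  proof (rule functional_in_span[where comb = "\<lambda>u c v i j k. u i j k + c * v i j k"])
    show "finite I" by (simp add: I_def)
  next
    fix v assume v: "v \<in> C_per N"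
      and zero: "\<And>p. p \<in> I \<Longrightarrow> (case p of (i, j, k) \<Rightarrow> lap L N v i j k) = 0"
    have "lap L N v i j k = 0" for i j k
      using C_per_representative[OF \<open>N \<ge> 1\<close> C_per_lap[OF v, of L], of i j k] zero
      by (force simp: I_def)
    then have "v = (\<lambda>i j k. v 0 0 0)"
      using lap_eq_0_imp_constant[OF assms(1,2) v] by blast
    then have "grid_inner L N f v = mesh L N ^ 3 * (v 0 0 0 * grid_sum N f)"
      unfolding grid_inner_def grid_sum_cmult[symmetric]
      by (metis (no_types, lifting) mult.commute)
    with f0 show "grid_inner L N f v = 0" by simp
  qed (auto simp: C_per_combine lap_combine grid_inner_combine_left grid_inner_commute[of L N f]
      split: prod.splits)
  then obtain c where c: "\<And>v. v \<in> C_per N \<Longrightarrow> grid_inner L N f v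
      = (\<Sum>p\<in>I. c p * (case p of (i, j, k) \<Rightarrow> lap L N v i j k))" by blast
  \<comment> \<open>The coefficients live on one period cell and are extended periodically; the division undoes
    the weight of the inner product.\<close>
  define r where "r i = (i - 1) mod int N + 1" for i :: int
  define u :: grid_fun where "u = (\<lambda>i j k. c (r i, r j, r k) / mesh L N ^ 3)"
  have r: "r i = i" if "i \<in> {1..int N}" for i
    using that by (simp add: r_def)
  have "i + int N - 1 = i - 1 + int N" for i by simp
  then have "r (i + int N) = r i" for i
    by (simp only: r_def mod_add_self2)
  then have u: "u \<in> C_per N" by (intro C_perI) (simp_all add: u_def)
  have weak: "grid_inner L N f v = grid_inner L N (lap L N u) v" if v: "v \<in> C_per N" for v
  proof -
    have "grid_inner L N f v = (\<Sum>(i, j, k)\<in>I. mesh L N ^ 3 * (u i j k * lap L N v i j k))"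
      unfolding c[OF v] using h by (intro sum.cong refl) (auto simp: I_def u_def r)
    also have "\<dots> = grid_inner L N u (lap L N v)"
      unfolding grid_inner_def grid_sum_cmult[symmetric] by (simp add: sumI)
    finally show ?thesis using lap_symmetric[OF u v] by simp
  qed
  define g where "g = (\<lambda>i j k. f i j k + (-1) * lap L N u i j k)"
  have g: "g \<in> C_per N"
    unfolding g_def by (intro C_per_combine fp C_per_lap u)
  have "grid_inner L N g g = 0"
    using weak[OF g] grid_inner_combine_left[of L N f "-1" "lap L N u" g, folded g_def] by simp
  then have gg0: "grid_sum N (\<lambda>i j k. g i j k * g i j k) = 0"
    using h by (simp add: grid_inner_def)
  have gg:  "(\<lambda>i j k. g i j k * g i j k) \<in> C_per N"
    by (intro C_perI) (simp_all add: C_perD[OF g])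
  have "g i j k = 0" for i j k
    using grid_sum_eq_0_imp[OF \<open>N \<ge> 1\<close> gg _ gg0, of i j k] by simp
  then have "lap L N u i j k = f i j k" for i j k
    by (simp add: g_def)
  with u show ?thesis by blast
qed

lemma inv_neg_lap:
  assumes "L > 0" "N \<ge> 1" and f: "f \<in> C_per0 L N"
  shows "inv_neg_lap L N f \<in> C_per N" "lap L N (inv_neg_lap L N f) i j k = - f i j k"
proof -
  let ?P = "\<lambda>\<psi>. \<psi> \<in> C_per0 L N \<and> (\<forall>i j k. - lap L N \<psi> i j k = f i j k)"
  obtain u where u: "u \<in> C_per N" "\<And>i j k. lap L N u i j k = f i j k"
    using poisson_solvable_up_to_constant[OF assms] by blast
  define a where "a = grid_sum N u / real N ^ 3"
  define \<psi> where "\<psi> = (\<lambda>i j k. a + (-1) * u i j k)"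
  have "\<psi> \<in> C_per N"
    unfolding \<psi>_def by (intro C_per_combine C_per_const u)
  moreover have "grid_sum N \<psi> = 0"
    using \<open>N \<ge> 1\<close> unfolding \<psi>_def grid_sum_add grid_sum_cmult grid_sum_const by (simp add: a_def)
  moreover have "- lap L N \<psi> i j k = f i j k" for i j k
    unfolding \<psi>_def lap_combine u(2) by (simp add: lap_def)
  ultimately have "?P \<psi>" using C_per0_iff assms by blast
  moreover have "\<xi> = \<psi>" if \<xi>: "?P \<xi>" for \<xi>
  proof -
    define w where "w = (\<lambda>i j k. \<xi> i j k + (-1) * \<psi> i j k)"
    have w: "w \<in> C_per N"
      unfolding w_def using \<xi> \<open>?P \<psi>\<close> C_per0_iff assms by (intro C_per_combine) auto
    have "lap L N w i j k = 0" for i j k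
    proof -
      have "- lap L N \<xi> i j k = - lap L N \<psi> i j k"
        using \<xi> \<open>?P \<psi>\<close> by metis
      then show ?thesis unfolding w_def lap_combine by simp
    qed
    then have const: "w = (\<lambda>i j k. w 0 0 0)"
      using lap_eq_0_imp_constant[OF assms(1,2) w] by blast
    have "grid_sum N w = 0"
      unfolding w_def grid_sum_add grid_sum_cmult using \<xi> \<open>?P \<psi>\<close> C_per0_iff assms by simp
    then have "w 0 0 0 = 0"
      using \<open>N \<ge> 1\<close> by (subst (asm) const) (simp add: grid_sum_const)
    then have "w i j k = 0" for i j k using const by metis
    then show ?thesis by (intro ext) (simp add: w_def)
  qed
  ultimately have "?P (inv_neg_lap L N f)"
    unfolding inv_neg_lap_def by (rule theI)
  then show "inv_neg_lap L N f \<in> C_per N" "lap L N (inv_neg_lap L N f) i j k = - f i j k"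
    using C_per0_iff assms by (blast, metis minus_minus)
qed

lemma grid_inner_eq_grad_inner_inv_neg_lap:
  assumes "L > 0" "N \<ge> 1" and f: "f \<in> C_per0 L N" and v: "v \<in> C_per N"
  shows "grid_inner L N f v = grad_inner L N (inv_neg_lap L N f) v"
proof -
  let ?\<psi> = "inv_neg_lap L N f"
  have "lap L N ?\<psi> = (\<lambda>i j k. 0 + (-1) * f i j k)"
    by (intro ext) (simp add: inv_neg_lap[OF assms(1-3)])
  then have "grid_inner L N v (lap L N ?\<psi>) = - grid_inner L N f v"
    by (simp only: grid_inner_commute[of L N v] grid_inner_combine_left)
      (simp add: grid_inner_def grid_sum_const)
  with summation_by_parts[OF v inv_neg_lap(1)[OF assms(1-3)], of L]
  show ?thesis by (simp add: grad_inner_commute)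
qed

lemma norm_m1_squared:
  assumes "L > 0" "N \<ge> 1" and f: "f \<in> C_per0 L N"
  shows "(norm_m1 L N f)\<^sup>2 = grad_inner L N (inv_neg_lap L N f) (inv_neg_lap L N f)"
  using grid_inner_eq_grad_inner_inv_neg_lap[OF assms inv_neg_lap(1)[OF assms]]
    grad_inner_self_nonneg[OF assms(1), of N "inv_neg_lap L N f"]
  by (simp add: norm_m1_def)

section \<open>Convexity of the stabilised Lennard-Jones potential\<close>

text \<open>With \<open>t\<^sup>3 = 2/15\<close> the minimum of \<open>24 x^5 - 8 x\<^sup>2\<close> over \<open>x > 0\<close> is attained at \<open>x = t\<close>, and for
  \<open>x = t y\<close> the left-hand side at the critical \<open>A0 = 9 t\<^sup>2 / 5\<close> factors as
  \<open>(8/5) t\<^sup>2 (y - 1)\<^sup>2 (2 y\<^sup>3 + 4 y\<^sup>2 + 6 y + 3)\<close>.\<close>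

lemma lennard_jones_quintic_nonneg:
  fixes x A0 :: real
  assumes "x > 0" and A0: "A0 \<ge> 9/5 * (2/15) powr (2/3)"
  shows "24 * x ^ 5 - 8 * x\<^sup>2 + 8/3 * A0 \<ge> 0"
proof -
  define t :: real where "t = (2/15) powr (1/3)"
  have "t > 0" by (simp add: t_def)
  have t3: "t ^ 3 = 2/15"
    by (simp add: t_def powr_power)
  have t2: "t\<^sup>2 = (2/15) powr (2/3)"
    by (simp add: t_def powr_power)
  define y where "y = x / t"
  have x: "x = t * y" and "y > 0" using \<open>t > 0\<close> assms(1) by (auto simp: y_def)
  have "x ^ 5 = t ^ 3 * t\<^sup>2 * y ^ 5"
    by (simp add: x power_mult_distrib power_add[symmetric])
  then have "24 * x ^ 5 - 8 * x\<^sup>2 + 24/5 * t\<^sup>2 = t\<^sup>2 * (8/5) * (2 * y ^ 5 - 5 * y\<^sup>2 + 3)"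
    by (simp add: t3 x power_mult_distrib algebra_simps)
  also have "2 * y ^ 5 - 5 * y\<^sup>2 + 3 = (y - 1)\<^sup>2 * (2 * y ^ 3 + 4 * y\<^sup>2 + 6 * y + 3)"
    by (simp add: algebra_simps power2_eq_square power3_eq_cube power_numeral_reduce)
  also have "t\<^sup>2 * (8/5) * \<dots> \<ge> 0"
    using \<open>y > 0\<close> by (intro mult_nonneg_nonneg add_nonneg_nonneg) auto
  finally show ?thesis using A0 t2 by simp
qed

lemma lennard_jones_convexified:
  fixes x A0 :: real
  assumes "x > 0" and "A0 \<ge> 9/5 * (2/15) powr (2/3)"
  shows "24 * x powi (-10) - 8 * x powi (-4) + 8/3 * A0 \<ge> 0"
proof -
  have "x powi (-10) = (inverse (x\<^sup>2)) ^ 5" "x powi (-4) = (inverse (x\<^sup>2))\<^sup>2"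
    by (simp_all add: power_int_minus power_inverse power_mult[symmetric])
  with lennard_jones_quintic_nonneg[of "inverse (x\<^sup>2)" A0] assms show ?thesis by simp
qed

text \<open>The tangent of the convex function \<open>a \<mapsto> a^-8/3 - 4 a^-2/3 + 4 A0 a\<^sup>2/3\<close> at \<open>b\<close> lies below its
  graph at \<open>a\<close>; the quadratic part contributes the remainder \<open>4 A0 (b - a)\<^sup>2/3\<close>.\<close>

lemma lennard_jones_tangent:
  fixes a b A0 :: real
  assumes "a > 0" "b > 0" and A0: "A0 \<ge> 9/5 * (2/15) powr (2/3)"
  shows "(1/3 * b powi (-8) - 4/3 * b powi (-2)) - (1/3 * a powi (-8) - 4/3 * a powi (-2))
     \<le> - 8/3 * (b powi (-9) - b powi (-3)) * (b - a) + 4/3 * A0 * (b - a)\<^sup>2"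
proof -
  let ?H = "\<lambda>x::real. 1/3 * x powi (-8) - 4/3 * x powi (-2) + 4/3 * A0 * x\<^sup>2"
  let ?H' = "\<lambda>x::real. - 8/3 * (x powi (-9) - x powi (-3)) + 8/3 * A0 * x"
  let ?H'' = "\<lambda>x::real. 24 * x powi (-10) - 8 * x powi (-4) + 8/3 * A0"
  have "?H' b * (a - b) \<le> ?H a - ?H b"
  proof (rule f''_imp_f'[where C = "{0<..}" and f'' = ?H''])
    show "DERIV ?H x :> ?H' x" if "x \<in> {0<..}" for x
      using that by (auto intro!: derivative_eq_intros
          simp: diff_divide_distrib right_diff_distrib mult.assoc)
    show "DERIV ?H' x :> ?H'' x" if "x \<in> {0<..}" for x
      using that by (auto intro!: derivative_eq_intros simp: diff_divide_distrib)
    show "?H'' x \<ge> 0" if "x \<in> {0<..}" for x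
      using that lennard_jones_convexified[OF _ A0] by simp
  qed (use assms in auto)
  then show ?thesis
    by (simp add: algebra_simps power2_eq_square add_divide_distrib diff_divide_distrib)
qed

section \<open>Energy stability\<close>

text \<open>The bulk part is the tangent inequality summed over the mesh.  For the Dirichlet part,
  polarisation gives an identity with the additional term \<open>-\<epsilon>\<^sup>2 \<parallel>\<nabla>(b - a)\<parallel>\<^sup>2/2\<close> on the right, which is
  dropped.\<close>

lemma F_h_increment_le:
  assumes "L > 0" and A0: "A0 \<ge> 9/5 * (2/15) powr (2/3)"
    and a: "\<And>i j k. a i j k > 0" and b: "\<And>i j k. b i j k > 0"
  shows "F_h L N \<epsilon> b - F_h L N \<epsilon> a
     \<le> grid_inner L N (\<lambda>i j k. - 8/3 * (b i j k powi (-9) - b i j k powi (-3))) (grid_diff b a)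
       + 4/3 * A0 * grid_inner L N (grid_diff b a) (grid_diff b a)
       + \<epsilon>\<^sup>2 * grad_inner L N b (grid_diff b a)"
proof -
  let ?d = "grid_diff b a"
  let ?m = "mesh L N ^ 3"
  let ?g = "\<lambda>i j k. - 8/3 * (b i j k powi (-9) - b i j k powi (-3))"
  let ?G = "\<lambda>\<phi> i j k. 1/3 * \<phi> i j k powi (-8) - 4/3 * \<phi> i j k powi (-2) :: real"
  have F: "F_h L N \<epsilon> \<phi> = ?m * grid_sum N (?G \<phi>) + \<epsilon>\<^sup>2 / 2 * grad_inner L N \<phi> \<phi>" for \<phi>
    unfolding F_h_def grad_norm2_squared[OF assms(1)] grid_sum_diff grid_sum_cmult grid_inner_def
    by (simp add: algebra_simps)
  have "grid_sum N (?G b) - grid_sum N (?G a)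
      \<le> grid_sum N (\<lambda>i j k. ?g i j k * ?d i j k + 4/3 * A0 * (?d i j k * ?d i j k))"
    unfolding grid_sum_diff[symmetric]
    using lennard_jones_tangent[OF a b A0]
    by (intro grid_sum_mono) (simp add: grid_diff_def power2_eq_square)
  also have "\<dots> = grid_sum N (\<lambda>i j k. ?g i j k * ?d i j k)
      + 4/3 * A0 * grid_sum N (\<lambda>i j k. ?d i j k * ?d i j k)"
    unfolding grid_sum_add grid_sum_cmult ..
  finally have "?m * (grid_sum N (?G b) - grid_sum N (?G a))
      \<le> ?m * (grid_sum N (\<lambda>i j k. ?g i j k * ?d i j k)
        + 4/3 * A0 * grid_sum N (\<lambda>i j k. ?d i j k * ?d i j k))"
    using mesh_nonneg[OF assms(1)] by (intro mult_left_mono) auto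
  then have bulk: "?m * (grid_sum N (?G b) - grid_sum N (?G a))
      \<le> grid_inner L N ?g ?d + 4/3 * A0 * grid_inner L N ?d ?d"
    by (simp add: grid_inner_def algebra_simps)
  have "a = (\<lambda>i j k. b i j k + (-1) * ?d i j k)"
    by (simp add: grid_diff_def)
  with grad_inner_square[of L N b "-1" ?d]
  have "grad_inner L N a a
      = grad_inner L N b b - 2 * grad_inner L N b ?d + grad_inner L N ?d ?d" by simp
  with grad_inner_self_nonneg[OF assms(1), of N ?d]
  have "\<epsilon>\<^sup>2 / 2 * (grad_inner L N b b - grad_inner L N a a)
      \<le> \<epsilon>\<^sup>2 / 2 * (2 * grad_inner L N b ?d)"
    by (intro mult_left_mono) auto
  with bulk show ?thesis by (simp add: F algebra_simps)
qed

theorem theorem4p2: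
  fixes L \<epsilon> A0 A dt M_h \<beta>0 :: real and N :: nat
    and \<phi>0 \<phi>1 \<phi>2 :: grid_fun
  assumes "L > 0" and "N \<ge> 1" and "dt > 0" and "\<epsilon> > 0"
    and "A0 \<ge> 9/5 * (2/15) powr (2/3)"
    and "A \<ge> 4/9 * A0\<^sup>2"
    and "\<phi>0 \<in> C_per N" and "\<phi>1 \<in> C_per N"
    and "M_h > 0"
    and "grid_norm_inf N \<phi>1 \<le> M_h" and "grid_norm_inf N \<phi>0 \<le> M_h"
    and "grid_mean L N \<phi>1 = \<beta>0" and "grid_mean L N \<phi>0 = \<beta>0" and "\<beta>0 > 0"
    and "\<forall>i j k. \<phi>1 i j k > 0"
    and "\<phi>2 \<in> C_per N"
    and "\<forall>i j k. \<phi>2 i j k > 0"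
    and "grid_diff \<phi>2 \<phi>1 \<in> C_per0 L N"
    and "bdf2_scheme L N \<epsilon> A0 A dt \<phi>0 \<phi>1 \<phi>2"
  shows "F_h_mod L N \<epsilon> A0 dt \<phi>2 \<phi>1 \<le> F_h_mod L N \<epsilon> A0 dt \<phi>1 \<phi>0"
proof -
  note LN = \<open>L > 0\<close> \<open>N \<ge> 1\<close>
  define d e where "d = grid_diff \<phi>2 \<phi>1" and "e = grid_diff \<phi>1 \<phi>0"
  define \<psi> \<eta> where "\<psi> = inv_neg_lap L N d" and "\<eta> = inv_neg_lap L N e"
  define \<mu> where "\<mu> = chem_pot L N \<epsilon> A0 A dt \<phi>0 \<phi>1 \<phi>2"
  define g where "g = (\<lambda>i j k. - 8/3 * (\<phi>2 i j k powi (-9) - \<phi>2 i j k powi (-3)))"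
  let ?ip = "grid_inner L N" and ?gr = "grad_inner L N"
  have d0: "d \<in> C_per0 L N" using assms by (simp add: d_def)
  have dp: "d \<in> C_per N" and ep: "e \<in> C_per N"
    using assms C_per_grid_diff by (auto simp: d_def e_def)
  have e0: "e \<in> C_per0 L N"
  proof -
    have "grid_mean L N e = grid_mean L N \<phi>1 - grid_mean L N \<phi>0"
      unfolding grid_mean_def e_def grid_diff_def grid_sum_diff by (rule right_diff_distrib)
    with ep assms show ?thesis by (simp add: C_per0_def)
  qed
  note \<psi>p = inv_neg_lap(1)[OF LN d0, folded \<psi>_def]
  note d_weak = grid_inner_eq_grad_inner_inv_neg_lap[OF LN d0, folded \<psi>_def]
  note e_weak = grid_inner_eq_grad_inner_inv_neg_lap[OF LN e0, folded \<eta>_def]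

  have \<mu>: "\<mu> = (\<lambda>i j k. g i j k + 8/3 * A0 * d i j k + (- (8/3) * A0) * e i j k
      + (- (A * dt)) * lap L N d i j k + (- \<epsilon>\<^sup>2) * lap L N \<phi>2 i j k)"
    by (intro ext) (simp add: \<mu>_def chem_pot_def g_def extrapolation_def d_def e_def grid_diff_def
        algebra_simps add_divide_distrib diff_divide_distrib)
  have gp: "g \<in> C_per N"
    by (intro C_perI) (simp_all add: g_def C_perD[OF \<open>\<phi>2 \<in> C_per N\<close>])
  have \<mu>p: "\<mu> \<in> C_per N"
    unfolding \<mu> by (intro C_per_combine C_per_lap gp dp ep \<open>\<phi>2 \<in> C_per N\<close>)
  have \<mu>d: "?ip \<mu> d = ?ip g d + 8/3 * A0 * ?ip d d - 8/3 * A0 * ?ip e d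
      + A * (dt * ?gr d d) + \<epsilon>\<^sup>2 * ?gr \<phi>2 d"
    unfolding \<mu> grid_inner_combine_left
    using summation_by_parts[OF dp dp, of L] summation_by_parts[OF dp \<open>\<phi>2 \<in> C_per N\<close>, of L]
    by (simp add: grid_inner_commute[of L N "lap L N _"] grad_inner_commute[of L N d \<phi>2])

  have scheme: "lap L N \<mu> i j k = (3/2 * \<phi>2 i j k - 2 * \<phi>1 i j k + 1/2 * \<phi>0 i j k) / dt" for i j k
    using \<open>bdf2_scheme L N \<epsilon> A0 A dt \<phi>0 \<phi>1 \<phi>2\<close> unfolding bdf2_scheme_def \<mu>_def by metis
  have "lap L N \<mu> = (\<lambda>i j k. 0 + (3 / (2 * dt)) * d i j k + (- (1 / (2 * dt))) * e i j k)"
    using \<open>dt > 0\<close> by (intro ext) (simp add: scheme d_def e_def grid_diff_def field_simps)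
  then have "?ip (lap L N \<mu>) \<psi> = 3 / (2 * dt) * ?ip d \<psi> - 1 / (2 * dt) * ?ip e \<psi>"
    by (simp only: grid_inner_combine_left) (simp add: grid_inner_def grid_sum_const)
  moreover have "?ip (lap L N \<mu>) \<psi> = - ?ip \<mu> d"
    using summation_by_parts[OF \<psi>p \<mu>p, of L] d_weak[OF \<mu>p]
    by (simp add: grid_inner_commute)
  ultimately have balance: "?ip \<mu> d + 3 / (2 * dt) * ?gr \<psi> \<psi> - 1 / (2 * dt) * ?gr \<eta> \<psi> = 0"
    using d_weak[OF \<psi>p] e_weak[OF \<psi>p] by simp

  have "0 \<le> ?gr \<eta> \<eta> - 2 * ?gr \<eta> \<psi> + ?gr \<psi> \<psi>"
    using grad_inner_square[of L N \<eta> "-1" \<psi>]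
      grad_inner_self_nonneg[OF LN(1), of N "\<lambda>i j k. \<eta> i j k + (-1) * \<psi> i j k"] by simp
  then have "0 \<le> 1 / (4 * dt) * (?gr \<eta> \<eta> - 2 * ?gr \<eta> \<psi> + ?gr \<psi> \<psi>)"
    using \<open>dt > 0\<close> by (intro mult_nonneg_nonneg) auto
  moreover have "3 / (2 * dt) * ?gr \<psi> \<psi> - 1 / (2 * dt) * ?gr \<eta> \<psi>
      = 1 / (4 * dt) * ?gr \<psi> \<psi> - 1 / (4 * dt) * ?gr \<eta> \<eta> + 1 / dt * ?gr \<psi> \<psi>
        + 1 / (4 * dt) * (?gr \<eta> \<eta> - 2 * ?gr \<eta> \<psi> + ?gr \<psi> \<psi>)"
    using \<open>dt > 0\<close> by (simp add: field_simps)
  ultimately have H: "3 / (2 * dt) * ?gr \<psi> \<psi> - 1 / (2 * dt) * ?gr \<eta> \<psi>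
      \<ge> 1 / (4 * dt) * ?gr \<psi> \<psi> - 1 / (4 * dt) * ?gr \<eta> \<eta> + 1 / dt * ?gr \<psi> \<psi>"
    by linarith

  have "A0 \<ge> 0" using assms(5) powr_ge_zero[of "2/15" "2/3"] by linarith
  have "?ip (\<lambda>i j k. d i j k + (-1) * e i j k) (\<lambda>i j k. d i j k + (-1) * e i j k)
      = ?ip d d - 2 * ?ip e d + ?ip e e"
    by (simp only: grid_inner_combine_left
        grid_inner_commute[of L N _ "\<lambda>i j k. d i j k + (-1) * e i j k"])
      (simp add: grid_inner_commute[of L N d e])
  with grid_inner_self_nonneg[OF LN(1), of N "\<lambda>i j k. d i j k + (-1) * e i j k"]
  have "0 \<le> ?ip d d - 2 * ?ip e d + ?ip e e" by simp
  then have "4/3 * A0 * (2 * ?ip e d) \<le> 4/3 * A0 * (?ip d d + ?ip e e)"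
    using \<open>A0 \<ge> 0\<close> by (intro mult_left_mono) auto
  then have S: "8/3 * A0 * ?ip d d - 8/3 * A0 * ?ip e d
      \<ge> 4/3 * A0 * ?ip d d - 4/3 * A0 * ?ip e e"
    by (simp add: algebra_simps)

  \<comment> \<open>Young's inequality; the weight makes the coefficient of the mixed term \<open>4 A0 / 3\<close>.\<close>
  have "0 \<le> ?gr \<psi> \<psi> + 2 * (- (2/3 * A0 * dt)) * ?gr \<psi> d + (- (2/3 * A0 * dt))\<^sup>2 * ?gr d d"
    unfolding grad_inner_square[symmetric] by (rule grad_inner_self_nonneg[OF LN(1)])
  then have "0 \<le> 1 / dt *
      (?gr \<psi> \<psi> + 2 * (- (2/3 * A0 * dt)) * ?gr \<psi> d + (- (2/3 * A0 * dt))\<^sup>2 * ?gr d d)"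
    using \<open>dt > 0\<close> by simp
  then have "4/3 * A0 * ?ip d d \<le> 1 / dt * ?gr \<psi> \<psi> + 4/9 * A0\<^sup>2 * (dt * ?gr d d)"
    using \<open>dt > 0\<close> d_weak[OF dp] by (simp add: field_simps power2_eq_square)
  moreover have "4/9 * A0\<^sup>2 * (dt * ?gr d d) \<le> A * (dt * ?gr d d)"
    using \<open>dt > 0\<close> \<open>A \<ge> 4/9 * A0\<^sup>2\<close> grad_inner_self_nonneg[OF LN(1)]
    by (intro mult_right_mono mult_nonneg_nonneg) auto
  ultimately have Y: "4/3 * A0 * ?ip d d \<le> 1 / dt * ?gr \<psi> \<psi> + A * (dt * ?gr d d)"
    by linarith

  have "F_h L N \<epsilon> \<phi>2 - F_h L N \<epsilon> \<phi>1 \<le> ?ip g d + 4/3 * A0 * ?ip d d + \<epsilon>\<^sup>2 * ?gr \<phi>2 d"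
    unfolding g_def d_def using assms by (intro F_h_increment_le) auto
  with balance \<mu>d H S Y
  have "F_h L N \<epsilon> \<phi>2 + 1 / (4 * dt) * ?gr \<psi> \<psi> + 4/3 * A0 * ?ip d d
      \<le> F_h L N \<epsilon> \<phi>1 + 1 / (4 * dt) * ?gr \<eta> \<eta> + 4/3 * A0 * ?ip e e"
    by linarith
  then show ?thesis
    unfolding F_h_mod_def d_def[symmetric] e_def[symmetric]
    by (simp only: norm_m1_squared[OF LN d0, folded \<psi>_def] norm_m1_squared[OF LN e0, folded \<eta>_def]
        grid_norm2_squared[OF LN(1)])
qed

end
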